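(* Let $n\ge1$, $k\ge0$ be integers, $\omega$ a primitive $n$-th root of unity, and $j\in\{1,\dots,n\}$. Put \[m_j=\frac{n+k}{\gcd(n,k,j)},\qquad n_j=\frac{n}{\gcd(n,j)}.\] (1) A necklace $N\in\mathcal{N}(n,k)$ is $m_j$-divisible if and only if $\operatorname{code}(N)$ is $n_j$-divisible. (2) For each $N\in\mathcal{N}(n,k)$ fix a word $a_N=a_{N,1}\cdots a_{N,n}$ representing $\operatorname{code}(N)$ and set \[f_N(y)=\frac1n\sum_{i=1}^n\omega^{-ij}y^{\sigma^i(a_N)},\qquad y^{a}=\prod_{i=1}^ny_i^{a_i}.\] Then $\{f_N: N\in\mathcal{N}(n,k)\text{ is }m_j\text{-divisible}\}$ is a $\mathbb{C}$-basis of the space of homogeneous polynomials $f\in\mathbb{C}[y_1,\dots,y_n]$ of degree $k$ satisfying $f(y_2,y_3,\dots,y_n,y_1)=\omega^jf(y_1,\dots,y_n)$ (the degree-$k$ $[D_j]$-relative invariants of the cyclic permutation representation $\rho'$ of $\operatorname{Jac}(C_n)^*$).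
   Context: For a finite color set $C$, the cyclic shift on words of length $n$ is $\sigma(c_1\cdots c_n)=c_nc_1\cdots c_{n-1}$; a necklace is an equivalence class $[w]$ of words under $w\sim\sigma^i(w)$; its period is the least $i>0$ with $\sigma^i(w)=w$; a necklace is $m$-divisible if its period is divisible by $m$. $\mathcal{N}(n,k)$ is the set of binary necklaces (colors black $b$, white $w$) with $n$ black and $k$ white beads. For $N=[bw^{a_1}bw^{a_2}\cdots bw^{a_n}]\in\mathcal{N}(n,k)$, $\operatorname{code}(N)=[a_1\cdots a_n]$, a necklace of length $n$ with colors in $\mathbb{N}$. (Here $\rho'$ sends the generator $\chi_1$ of $\operatorname{Jac}(C_n)^*$, with $\chi_1([v_1-v_n])=\omega$, to the permutation matrix $P$ with $Pe_i=e_{i-1}$, indices mod $n$, and $(f\circ P)(y)=f(y_2,\dots,y_n,y_1)$; $[D_j]$, $D_j=v_j-v_n$, acts as the character $\rho'(\chi_1)\mapsto\omega^j$.) *)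

theory Defs
  imports Complex_Main "HOL-Library.Poly_Mapping"
begin

section \<open>Words and necklaces\<close>

definition cyc_shift :: "'c list \<Rightarrow> 'c list" where
  "cyc_shift w = (if w = [] then [] else last w # butlast w)"

definition shift_rel :: "('c list \<times> 'c list) set" where
  "shift_rel = {(v, w). \<exists>i. w = (cyc_shift ^^ i) v}"

definition necklace :: "'c list \<Rightarrow> 'c list set" where
  "necklace w = shift_rel `` {w}"

definition period :: "'c list set \<Rightarrow> nat" where
  "period N = (LEAST i. 0 < i \<and> (\<forall>w\<in>N. (cyc_shift ^^ i) w = w))"

definition divisible_necklace :: "nat \<Rightarrow> 'c list set \<Rightarrow> bool" where
  "divisible_necklace m N \<longleftrightarrow> m dvd period N"

datatype bead = Black | White

definition binary_necklaces :: "nat \<Rightarrow> nat \<Rightarrow> bead list set set" where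
  "binary_necklaces n k =
     {w. count_list w Black = n \<and> count_list w White = k} // shift_rel"

definition code_word :: "nat list \<Rightarrow> bead list" where
  "code_word as = concat (map (\<lambda>a. Black # replicate a White) as)"

definition code :: "bead list set \<Rightarrow> nat list set" where
  "code N = (THE M. \<exists>as. N = necklace (code_word as) \<and> M = necklace as)"


lemma cyc_shift_rotate1 [simp]: "cyc_shift (rotate1 w) = w"
  by (cases w) (auto simp: cyc_shift_def)

lemma rotate1_cyc_shift [simp]: "rotate1 (cyc_shift w) = w"
  by (auto simp: cyc_shift_def)

lemma length_cyc_shift_pow [simp]: "length ((cyc_shift ^^ i) w) = length w"
proof (induction i)
  case (Suc i)
  have "length (cyc_shift v) = length v" for v :: "'a list"
    by (simp add: cyc_shift_def)
  then show ?case using Suc by simp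
qed simp

lemma cyc_shift_pow_rotate: "(cyc_shift ^^ i) (rotate i w) = w"
  by (induction i arbitrary: w) (simp_all add: funpow_Suc_right del: funpow.simps)

lemma rotate_cyc_shift_pow: "rotate i ((cyc_shift ^^ i) w) = w"
proof (induction i arbitrary: w)
  case (Suc i)
  have "rotate (Suc i) ((cyc_shift ^^ Suc i) w)
      = rotate1 (rotate i ((cyc_shift ^^ i) (cyc_shift w)))"
    by (simp add: funpow_Suc_right del: funpow.simps)
  then show ?case using Suc by simp
qed simp

lemma cyc_shift_pow_mult_length: "(cyc_shift ^^ (i * length w)) w = w"
  using cyc_shift_pow_rotate[of "i * length w" w] by (simp add: rotate_id)

lemma shift_rel_iff_rotate: "(v, w) \<in> shift_rel \<longleftrightarrow> (\<exists>i. v = rotate i w)"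
proof -
  have "w = (cyc_shift ^^ i) v \<longleftrightarrow> v = rotate i w" for i
    by (metis rotate_cyc_shift_pow cyc_shift_pow_rotate)
  then show ?thesis unfolding shift_rel_def by simp
qed

lemma equiv_shift_rel: "equiv UNIV (shift_rel :: ('c list \<times> 'c list) set)"
proof (rule equivI)
  show "refl (shift_rel :: ('c list \<times> 'c list) set)"
    by (auto simp: refl_on_def shift_rel_def intro: exI[of _ 0])
  show "trans (shift_rel :: ('c list \<times> 'c list) set)"
    unfolding trans_def shift_rel_iff_rotate by (metis rotate_rotate)
  show "sym (shift_rel :: ('c list \<times> 'c list) set)"
  proof (rule symI)
    fix v w :: "'c list"
    assume "(v, w) \<in> shift_rel"
    then obtain i where v: "v = rotate i w" by (auto simp: shift_rel_iff_rotate)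
    have "w = rotate (length w * i - i) v"
    proof (cases "w = []")
      case False
      then have "i \<le> length w * i" by (cases w) auto
      then have "rotate (length w * i - i) v = rotate (length w * i) w"
        unfolding v rotate_rotate by simp
      also have "\<dots> = w" by (rule rotate_id) simp
      finally show ?thesis by (rule sym)
    qed (simp add: v)
    then show "(w, v) \<in> shift_rel" by (auto simp: shift_rel_iff_rotate)
  qed
qed simp

lemma necklace_eq_iff: "necklace v = necklace w \<longleftrightarrow> (v, w) \<in> shift_rel"
  unfolding necklace_def by (rule eq_equiv_class_iff[OF equiv_shift_rel UNIV_I UNIV_I])

text \<open>The period of a necklace can be computed from any representative.\<close>

lemma period_necklace: "period (necklace w) = (LEAST i. 0 < i \<and> (cyc_shift ^^ i) w = w)"
proof -
  have "(\<forall>v\<in>necklace w. (cyc_shift ^^ i) v = v) \<longleftrightarrow> (cyc_shift ^^ i) w = w" for i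
  proof
    assume "\<forall>v\<in>necklace w. (cyc_shift ^^ i) v = v"
    moreover have "w \<in> necklace w"
      unfolding necklace_def by (rule equiv_class_self[OF equiv_shift_rel UNIV_I])
    ultimately show "(cyc_shift ^^ i) w = w" by blast
  next
    assume *: "(cyc_shift ^^ i) w = w"
    show "\<forall>v\<in>necklace w. (cyc_shift ^^ i) v = v"
    proof
      fix v assume "v \<in> necklace w"
      then obtain l where v: "v = (cyc_shift ^^ l) w"
        by (auto simp: necklace_def shift_rel_def)
      have "(cyc_shift ^^ i) v = (cyc_shift ^^ l) ((cyc_shift ^^ i) w)"
        unfolding v by (metis add.commute comp_apply funpow_add)
      then show "(cyc_shift ^^ i) v = v" using * v by simp
    qed
  qed
  then show ?thesis by (simp add: period_def)
qed

lemma code_word_simps [simp]: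
  "code_word [] = []"
  "code_word (a # as) = Black # replicate a White @ code_word as"
  "code_word (as @ bs) = code_word as @ code_word bs"
  by (simp_all add: code_word_def)

lemma count_code_word:
  "count_list (code_word as) Black = length as"
  "count_list (code_word as) White = sum_list as"
proof -
  have r: "count_list (replicate a White) Black = 0"
          "count_list (replicate a White) White = a" for a
    by (induction a) auto
  show "count_list (code_word as) Black = length as"
       "count_list (code_word as) White = sum_list as"
    by (induction as) (simp_all add: r)
qed

lemma code_word_cases: "code_word as = [] \<or> (\<exists>w. code_word as = Black # w)"
  by (cases as) auto

lemma White_replicate_eq:
  "replicate a White @ code_word as = replicate b White @ code_word bs
     \<Longrightarrow> a = b \<and> code_word as = code_word bs"
proof (induction a arbitrary: b)
  case 0
  then show ?case using code_word_cases[of as] by (cases b) auto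
next
  case (Suc a)
  then show ?case using code_word_cases[of bs] by (cases b) auto
qed

lemma code_word_inject: "code_word as = code_word bs \<Longrightarrow> as = bs"
proof (induction as arbitrary: bs)
  case Nil
  then show ?case by (cases bs) auto
next
  case (Cons a as)
  then show ?case by (cases bs) (auto dest!: White_replicate_eq)
qed

lemma code_word_split:
  "code_word as = u @ Black # v
     \<Longrightarrow> \<exists>bs cs. as = bs @ cs \<and> u = code_word bs \<and> Black # v = code_word cs"
proof (induction as arbitrary: u)
  case (Cons a as)
  show ?case
  proof (cases u)
    case Nil
    then show ?thesis using Cons.prems by (intro exI[of _ "[]"] exI[of _ "a # as"]) auto
  next
    case (Cons x u')
    have x: "x = Black" and eq: "replicate a White @ code_word as = u' @ Black # v"
      using Cons.prems Cons by auto
    have "\<exists>u''. u' = replicate a White @ u'' \<and> code_word as = u'' @ Black # v"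
      using eq
    proof (induction a arbitrary: u')
      case (Suc a)
      then show ?case by (cases u') auto
    qed simp
    then obtain u'' where u'': "u' = replicate a White @ u''" "code_word as = u'' @ Black # v"
      by blast
    from Cons.IH[OF u''(2)] obtain bs cs
      where "as = bs @ cs" "u'' = code_word bs" "Black # v = code_word cs" by blast
    then show ?thesis using Cons x u''(1)
      by (intro exI[of _ "a # bs"] exI[of _ cs]) auto
  qed
qed simp

lemma necklace_code_word_eq_iff:
  "necklace (code_word as) = necklace (code_word bs) \<longleftrightarrow> necklace as = necklace bs"
proof
  assume "necklace as = necklace bs"
  then obtain i where "as = rotate i bs"
    by (auto simp: necklace_eq_iff shift_rel_iff_rotate)
  moreover have "\<exists>l. code_word (rotate i bs) = rotate l (code_word bs)"
  proof (induction i)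
    case 0
    show ?case by (intro exI[of _ 0]) simp
  next
    case (Suc i)
    then obtain l where l: "code_word (rotate i bs) = rotate l (code_word bs)" by blast
    show ?case
    proof (cases "rotate i bs")
      case Nil
      then show ?thesis by (intro exI[of _ 0]) simp
    next
      case (Cons c cs)
      have "code_word (rotate (Suc i) bs) = code_word cs @ code_word [c]"
        using Cons by simp
      also have "\<dots> = rotate (length (code_word [c])) (code_word [c] @ code_word cs)"
        by (simp only: rotate_append)
      also have "code_word [c] @ code_word cs = rotate l (code_word bs)"
        using l Cons by simp
      finally show ?thesis unfolding rotate_rotate by blast
    qed
  qed
  ultimately show "necklace (code_word as) = necklace (code_word bs)"
    by (auto simp: necklace_eq_iff shift_rel_iff_rotate)
next
  assume "necklace (code_word as) = necklace (code_word bs)"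
  then obtain i where i: "code_word as = rotate i (code_word bs)"
    by (auto simp: necklace_eq_iff shift_rel_iff_rotate)
  define l where "l = i mod length (code_word bs)"
  define u v where "u = take l (code_word bs)" and "v = drop l (code_word bs)"
  have bs: "code_word bs = u @ v" by (simp add: u_def v_def)
  have as: "code_word as = v @ u"
    using i unfolding u_def v_def l_def by (simp add: rotate_drop_take)
  have "\<exists>bs1 bs2. bs = bs1 @ bs2 \<and> u = code_word bs1 \<and> v = code_word bs2"
  proof (cases v)
    case Nil
    then show ?thesis using bs by (intro exI[of _ bs] exI[of _ "[]"]) simp
  next
    case (Cons x v')
    then have "x = Black" using as code_word_cases[of as] by auto
    then show ?thesis using bs Cons code_word_split[of bs u v'] by blast
  qed
  then obtain bs1 bs2 where *: "bs = bs1 @ bs2" "u = code_word bs1" "v = code_word bs2"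
    by blast
  then have "as = bs2 @ bs1" using as by (intro code_word_inject) simp
  then have "as = rotate (length bs1) bs" using * by (simp add: rotate_append)
  then show "necklace as = necklace bs"
    by (auto simp: necklace_eq_iff shift_rel_iff_rotate)
qed

text \<open>The description of \<open>code\<close> determines a unique necklace.\<close>

lemma code_necklace: "code (necklace (code_word as)) = necklace as"
  unfolding code_def by (rule the_equality) (auto simp: necklace_code_word_eq_iff)

lemma ex_code_word: "\<exists>a as. w = replicate a White @ code_word as"
proof (induction w)
  case Nil
  show ?case by (intro exI[of _ 0] exI[of _ "[]"]) simp
next
  case (Cons x w)
  then obtain a as where w: "w = replicate a White @ code_word as" by blast
  show ?case
  proof (cases x)
    case Black
    then show ?thesis using w by (intro exI[of _ 0] exI[of _ "a # as"]) simp
  next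
    case White
    then show ?thesis using w by (intro exI[of _ "Suc a"] exI[of _ as]) simp
  qed
qed

text \<open>Every necklace with a black bead has the form to which \<open>code\<close> applies.\<close>

lemma binary_necklaces_code_word:
  assumes "n \<ge> 1" "N \<in> binary_necklaces n k"
  obtains as where "N = necklace (code_word as)" "length as = n" "sum_list as = k"
proof -
  obtain w where w: "count_list w Black = n" "count_list w White = k" "N = necklace w"
    using assms(2) by (auto simp: binary_necklaces_def quotient_def necklace_def)
  then have "Black \<in> set w" using assms(1) count_list_0_iff[of w Black] by auto
  then obtain u v where uv: "w = u @ Black # v" by (auto dest: split_list)
  obtain a as where as: "v @ u = replicate a White @ code_word as"
    using ex_code_word by blast
  have eq: "(Black # v) @ u = code_word (a # as)" using as by simp
  have "necklace (code_word (a # as)) = necklace w"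
    unfolding necklace_eq_iff shift_rel_iff_rotate eq[symmetric] uv
    by (metis rotate_append)
  moreover have "count_list (code_word (a # as)) c = count_list w c" for c
    unfolding eq[symmetric] uv by simp
  ultimately show ?thesis
    using that[of "a # as"] w count_code_word[of "a # as"] by metis
qed


section \<open>Multivariate complex polynomials\<close>

text \<open>Finitely supported maps from exponent vectors to coefficients; the ring structure
  is the convolution product of \<^theory>\<open>HOL-Library.Poly_Mapping\<close>. The variables
  \<open>y\<^sub>1, y\<^sub>2, \<dots>\<close> are indexed from 1.\<close>

type_synonym mpoly = "(nat \<Rightarrow>\<^sub>0 nat) \<Rightarrow>\<^sub>0 complex"

definition mvar :: "nat \<Rightarrow> mpoly" where
  "mvar i = Poly_Mapping.single (Poly_Mapping.single i 1) 1"

definition mscale :: "complex \<Rightarrow> mpoly \<Rightarrow> mpoly" where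
  "mscale c p = Poly_Mapping.single 0 c * p"

definition msubst :: "(nat \<Rightarrow> mpoly) \<Rightarrow> mpoly \<Rightarrow> mpoly" where
  "msubst s p = (\<Sum>e\<in>Poly_Mapping.keys p. mscale (Poly_Mapping.lookup p e)
     (\<Prod>i\<in>Poly_Mapping.keys e. s i ^ Poly_Mapping.lookup e i))"

text \<open>Homogeneous polynomials of degree \<open>k\<close> in \<open>y\<^sub>1, \<dots>, y\<^sub>n\<close>, including 0.\<close>

definition homogeneous_polys :: "nat \<Rightarrow> nat \<Rightarrow> mpoly set" where
  "homogeneous_polys n k = {p. \<forall>e\<in>Poly_Mapping.keys p. Poly_Mapping.keys e \<subseteq> {1..n} \<and>
     (\<Sum>i\<in>Poly_Mapping.keys e. Poly_Mapping.lookup e i) = k}"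

global_interpretation mpoly: vector_space mscale
proof
  fix a b :: complex and x y :: mpoly
  show "mscale a (x + y) = mscale a x + mscale a y"
    by (simp add: mscale_def algebra_simps)
  show "mscale (a + b) x = mscale a x + mscale b x"
    by (simp add: mscale_def single_add algebra_simps)
  show "mscale a (mscale b x) = mscale (a * b) x"
    by (simp add: mscale_def mult_single flip: mult.assoc)
  show "mscale 1 x = x"
    by (simp add: mscale_def)
qed

definition primitive_root_of_unity :: "nat \<Rightarrow> complex \<Rightarrow> bool" where
  "primitive_root_of_unity n \<omega> \<longleftrightarrow> \<omega> ^ n = 1 \<and> (\<forall>i. 0 < i \<and> i < n \<longrightarrow> \<omega> ^ i \<noteq> 1)"

text \<open>Letters of a word are counted from 1, so that \<open>a\<^sub>i = a ! (i - 1)\<close>.\<close>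

definition word_monom :: "nat list \<Rightarrow> mpoly" where
  "word_monom a = (\<Prod>i=1..length a. mvar i ^ (a ! (i - 1)))"

definition necklace_poly :: "nat \<Rightarrow> complex \<Rightarrow> nat \<Rightarrow> nat list \<Rightarrow> mpoly" where
  "necklace_poly n \<omega> j a =
     mscale (1 / of_nat n)
       (\<Sum>i=1..n. mscale (\<omega> powi (- (int i * int j))) (word_monom ((cyc_shift ^^ i) a)))"

text \<open>Substituting \<open>y\<^bsub>i mod n + 1\<^esub>\<close> for \<open>y\<^sub>i\<close> gives \<open>f (y\<^sub>2, \<dots>, y\<^sub>n, y\<^sub>1)\<close>.\<close>

definition relative_invariants :: "nat \<Rightarrow> nat \<Rightarrow> complex \<Rightarrow> nat \<Rightarrow> mpoly set" where
  "relative_invariants n k \<omega> j =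
     {f \<in> homogeneous_polys n k. msubst (\<lambda>i. mvar (i mod n + 1)) f = mscale (\<omega> ^ j) f}"

end

theory Submission
  imports Defs
begin

text \<open>
  If a code word of length \<open>n\<close> has period \<open>d\<close> and \<open>n = d * r\<close>, then the corresponding binary word,
  of length \<open>n + k\<close>, has period \<open>p\<close> with \<open>n + k = p * r\<close>; both divisibility conditions
  say that \<open>r\<close> divides \<open>j\<close>, equivalently that \<open>n\<close> divides \<open>d * j\<close>.

  The substitution maps the monomial of a word to the monomial of its cyclic shift, hence
  shifting the word multiplies its necklace polynomial by \<open>\<omega> ^ j\<close>. A word fixed by \<open>d\<close> shifts
  therefore has polynomial 0 unless \<open>n\<close> divides \<open>d * j\<close>. Averaging a relative invariant
  over the cyclic group exhibits it as a combination of necklace polynomials, and these are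
  independent because their monomials lie in distinct orbits.
\<close>

section \<open>Periods\<close>

lemma cyc_shift_pow_fixed_mult:
  assumes "(cyc_shift ^^ d) w = w"
  shows "(cyc_shift ^^ (d * q)) w = w"
  using assms by (induction q) (simp_all add: funpow_add)

lemma period_necklace_pos_fixed:
  "0 < period (necklace w) \<and> (cyc_shift ^^ period (necklace w)) w = w"
proof -
  have "\<exists>i. 0 < i \<and> (cyc_shift ^^ i) w = w"
  proof (cases "w = []")
    case True
    then show ?thesis by (intro exI[of _ 1]) (simp add: cyc_shift_def)
  next
    case False
    then show ?thesis using cyc_shift_pow_mult_length[of 1 w]
      by (intro exI[of _ "length w"]) simp
  qed
  then show ?thesis unfolding period_necklace by (rule LeastI_ex)
qed

text \<open>The remainder of \<open>i\<close> modulo the period also fixes \<open>w\<close> and lies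
  below the least positive fixing shift, so it must be 0.\<close>

lemma period_necklace_dvd_iff:
  "period (necklace w) dvd i \<longleftrightarrow> (cyc_shift ^^ i) w = w"
proof
  let ?d = "period (necklace w)"
  assume i: "(cyc_shift ^^ i) w = w"
  have "(cyc_shift ^^ (i mod ?d)) w = (cyc_shift ^^ (i mod ?d)) ((cyc_shift ^^ (?d * (i div ?d))) w)"
    using cyc_shift_pow_fixed_mult period_necklace_pos_fixed by metis
  also have "\<dots> = (cyc_shift ^^ (i mod ?d + ?d * (i div ?d))) w"
    by (simp only: funpow_add comp_apply)
  also have "\<dots> = w" using i by simp
  finally have fixed: "(cyc_shift ^^ (i mod ?d)) w = w" .
  have less: "i mod ?d < ?d" using period_necklace_pos_fixed[of w] by simp
  then have "\<not> (0 < i mod ?d \<and> (cyc_shift ^^ (i mod ?d)) w = w)"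
    unfolding period_necklace[of w] by (rule not_less_Least)
  then show "?d dvd i" using fixed by (simp add: dvd_eq_mod_eq_0)
next
  assume "period (necklace w) dvd i"
  then show "(cyc_shift ^^ i) w = w"
    using cyc_shift_pow_fixed_mult period_necklace_pos_fixed by (metis dvdE)
qed

lemma period_necklace_dvd_length: "period (necklace w) dvd length w"
  unfolding period_necklace_dvd_iff using cyc_shift_pow_mult_length[of 1 w] by simp

section \<open>Periods and factorizations into commuting words\<close>

lemma period_append_commute:
  assumes "u @ v = v @ u"
  shows "period (necklace (u @ v)) dvd length u"
proof -
  have "rotate (length u) (u @ v) = u @ v" using assms rotate_append[of u v] by simp
  then show ?thesis unfolding period_necklace_dvd_iff by (metis cyc_shift_pow_rotate)
qed

text \<open>Cutting after one period gives two factors whose exchange is a rotation fixing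
  \<open>w\<close>. Periods are handled through such factorizations because \<open>code_word\<close>
  respects concatenation, whereas it changes the number of shifts.\<close>

lemma period_split:
  assumes "w \<noteq> []"
  obtains u v where "w = u @ v" "u @ v = v @ u" "length u = period (necklace w)"
proof
  let ?d = "period (necklace w)"
  have le: "?d \<le> length w"
    using assms by (intro dvd_imp_le period_necklace_dvd_length) simp
  show w: "w = take ?d w @ drop ?d w" by simp
  show l: "length (take ?d w) = ?d" using le by simp
  have "rotate ?d w = w"
    using rotate_cyc_shift_pow[of ?d w] period_necklace_pos_fixed[of w] by simp
  moreover have "rotate ?d w = drop ?d w @ take ?d w"
    using rotate_append[of "take ?d w" "drop ?d w"] l by simp
  ultimately show "take ?d w @ drop ?d w = drop ?d w @ take ?d w" by simp
qed

text \<open>Commuting words are powers of one common word, so letter sums are proportional to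
  lengths.\<close>

lemma sum_list_append_commute:
  fixes u v :: "nat list"
  assumes "u @ v = v @ u"
  shows "length (u @ v) * sum_list u = length u * sum_list (u @ v)"
proof -
  obtain p q zs where u: "concat (replicate p zs) = u" and v: "concat (replicate q zs) = v"
    using comm_append_are_replicate[OF assms] by blast
  have "sum_list (concat (replicate m zs)) = m * sum_list zs"
       "length (concat (replicate m zs)) = m * length zs" for m
    by (induction m) simp_all
  then show ?thesis unfolding u[symmetric] v[symmetric] by (simp add: algebra_simps)
qed

lemma length_code_word: "length (code_word as) = length as + sum_list as"
  by (induction as) simp_all

text \<open>The first period of \<open>as\<close> encodes to the first period of the binary word,
  since both come from the shortest nonempty prefix of \<open>as\<close> that commutes with the
  rest. Written without division, the equation says that both words consist of the same number of
  repetitions.\<close>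

lemma period_code_word:
  assumes "as \<noteq> []"
  shows "period (necklace (code_word as)) * length as
           = period (necklace as) * (length as + sum_list as)"
proof -
  let ?d = "period (necklace as)" and ?p = "period (necklace (code_word as))"
  obtain u v where uv: "as = u @ v" "u @ v = v @ u" "length u = ?d"
    using period_split[OF assms] by blast
  have "code_word u @ code_word v = code_word v @ code_word u"
    using uv(2) code_word_simps(3) by metis
  from period_append_commute[OF this] have dvd: "?p dvd length (code_word u)"
    using uv(1) by simp
  have "code_word as \<noteq> []" using assms by (cases as) auto
  then obtain U V where UV: "code_word as = U @ V" "U @ V = V @ U" "length U = ?p"
    using period_split by blast
  \<comment> \<open>A nonempty \<open>V\<close> is a prefix of \<open>code_word as\<close> and so
    starts with a black bead; the cut therefore falls at the start of a block and comes from a cut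
    of \<open>as\<close>.\<close>
  have "\<exists>u' v'. as = u' @ v' \<and> U = code_word u' \<and> V = code_word v'"
  proof (cases V)
    case Nil
    then show ?thesis using UV by (intro exI[of _ as] exI[of _ "[]"]) simp
  next
    case (Cons x V')
    then have "x = Black" using UV code_word_cases[of as] by auto
    then show ?thesis using UV Cons code_word_split[of as U V'] by blast
  qed
  then obtain u' v' where uv': "as = u' @ v'" "U = code_word u'" "V = code_word v'" by blast
  have "u' @ v' = v' @ u'" using UV(2) uv' by (intro code_word_inject) simp
  from period_append_commute[OF this] have "?d dvd length u'" using uv' by simp
  moreover have "u' \<noteq> []"
    using UV(3) uv'(2) period_necklace_pos_fixed[of "code_word as"] by auto
  ultimately have le: "length u \<le> length u'" using uv(3) by (simp add: dvd_imp_le)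
  \<comment> \<open>Both \<open>u\<close> and \<open>u'\<close> are prefixes of \<open>as\<close>,
    so the shorter is a prefix of the longer, and the lengths of their encodings compare
    likewise.\<close>
  then have "u' = u @ take (length u' - length u) v"
    using uv(1) uv'(1) by (metis append_eq_conv_conj take_append take_all)
  then have "length (code_word u) \<le> ?p"
    using UV(3) uv'(2) by (metis code_word_simps(3) le_add1 length_append)
  moreover have "?p \<le> length (code_word u)"
  proof (rule dvd_imp_le[OF dvd])
    have "u \<noteq> []" using uv(3) period_necklace_pos_fixed[of as] by auto
    then show "0 < length (code_word u)" by (simp add: length_code_word)
  qed
  ultimately have "?p = length u + sum_list u" by (simp add: length_code_word)
  then show ?thesis
    using sum_list_append_commute[OF uv(2)] uv(1,3) by (simp add: algebra_simps)
qed

section \<open>Comparison of the two divisibility conditions\<close>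

lemma div_dvd_iff_dvd:
  fixes N g d r :: nat
  assumes "N = d * r" "g dvd N" "0 < N"
  shows "N div g dvd d \<longleftrightarrow> r dvd g"
proof -
  have g: "0 < g" and d: "0 < d" using assms by (auto intro!: Nat.gr0I)
  have "N div g dvd d \<longleftrightarrow> N div g * g dvd d * g" using g by simp
  also have "\<dots> \<longleftrightarrow> d * r dvd d * g" using assms by simp
  also have "\<dots> \<longleftrightarrow> r dvd g" using d by simp
  finally show ?thesis .
qed

text \<open>The number \<open>r\<close> of repetitions is common to both words, so it divides
  \<open>n\<close> and \<open>n + k\<close>, hence also \<open>k\<close>. Each gcd condition thus
  reduces to \<open>r\<close> dividing \<open>j\<close>. The common right-hand side is the form that
  decides whether a necklace polynomial vanishes.\<close>

lemma divisible_code_iff: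
  fixes as :: "nat list"
  assumes "length as = n" "sum_list as = k" "1 \<le> n"
  shows "(n + k) div gcd n (gcd k j) dvd period (necklace (code_word as))
           \<longleftrightarrow> n dvd period (necklace as) * j"
    and "n div gcd n j dvd period (necklace as) \<longleftrightarrow> n dvd period (necklace as) * j"
proof -
  let ?d = "period (necklace as)" and ?p = "period (necklace (code_word as))"
  have dpos: "0 < ?d" using period_necklace_pos_fixed[of as] by simp
  obtain r where r: "n = ?d * r" using period_necklace_dvd_length[of as] assms by auto
  have "?p * n = ?d * (n + k)" using period_code_word[of as] assms by fastforce
  then have "?d * (?p * r) = ?d * (n + k)" using r by (metis mult.left_commute)
  then have nk: "n + k = ?p * r" using dpos by simp
  have rn: "r dvd n" using r by (metis dvd_triv_right)
  have rk: "r dvd k" using nk rn by (metis dvd_add_right_iff dvd_triv_right)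
  have rj: "n dvd ?d * j \<longleftrightarrow> r dvd j" using dpos by (subst r) simp
  have "(n + k) div gcd n (gcd k j) dvd ?p \<longleftrightarrow> r dvd gcd n (gcd k j)"
    by (rule div_dvd_iff_dvd[OF nk]) (use assms in \<open>auto intro: dvd_add dvd_trans[OF gcd_dvd2]\<close>)
  then show "(n + k) div gcd n (gcd k j) dvd ?p \<longleftrightarrow> n dvd ?d * j"
    using rn rk rj by simp
  have "n div gcd n j dvd ?d \<longleftrightarrow> r dvd gcd n j"
    by (rule div_dvd_iff_dvd[OF r]) (use assms in auto)
  then show "n div gcd n j dvd ?d \<longleftrightarrow> n dvd ?d * j"
    using rn rj by simp
qed

section \<open>Monomials of words\<close>

lemma lookup_mscale: "Poly_Mapping.lookup (mscale c p) e = c * Poly_Mapping.lookup p e"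
  unfolding mscale_def mult_map_scale_conv_mult[symmetric]
  by (simp add: Poly_Mapping.map.rep_eq when_def)

lemma lookup_sum_mpoly:
  "Poly_Mapping.lookup (\<Sum>x\<in>A. p x) e = (\<Sum>x\<in>A. Poly_Mapping.lookup (p x :: mpoly) e)"
  by (induction A rule: infinite_finite_induct) (simp_all add: lookup_add)

text \<open>Makes \<open>word_monom a\<close> a single term, so that extracting coefficients becomes
  a comparison of words.\<close>

definition word_exponents :: "nat list \<Rightarrow> nat \<Rightarrow>\<^sub>0 nat" where
  "word_exponents a = (\<Sum>i=1..length a. Poly_Mapping.single i (a ! (i - 1)))"

lemma lookup_word_exponents:
  "Poly_Mapping.lookup (word_exponents a) i = (if i \<in> {1..length a} then a ! (i - 1) else 0)"
proof -
  have "Poly_Mapping.lookup (\<Sum>x\<in>A. Poly_Mapping.single x (g x)) i = (if i \<in> A then g i else 0)"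
    if "finite A" for A and g :: "nat \<Rightarrow> nat"
    using that by (induction A) (auto simp: lookup_add lookup_single when_def)
  then show ?thesis unfolding word_exponents_def by simp
qed

text \<open>Trailing zeros leave no trace in an exponent vector, so words are compared at equal
  length.\<close>

lemma word_exponents_inject:
  assumes "length a = length b" "word_exponents a = word_exponents b"
  shows "a = b"
proof (rule nth_equalityI)
  fix i assume "i < length a"
  then show "a ! i = b ! i"
    using lookup_word_exponents[of a "Suc i"] lookup_word_exponents[of b "Suc i"] assms by simp
qed (rule assms)

lemma keys_word_exponents: "Poly_Mapping.keys (word_exponents a) \<subseteq> {1..length a}"
  by (auto simp: in_keys_iff lookup_word_exponents split: if_splits)

lemma sum_lookup_word_exponents:
  "(\<Sum>i\<in>Poly_Mapping.keys (word_exponents a). Poly_Mapping.lookup (word_exponents a) i) = sum_list a"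
proof -
  have "(\<Sum>i\<in>Poly_Mapping.keys (word_exponents a). Poly_Mapping.lookup (word_exponents a) i)
      = (\<Sum>i\<in>{1..length a}. Poly_Mapping.lookup (word_exponents a) i)"
    by (rule sum.mono_neutral_left) (use keys_word_exponents in \<open>auto simp: in_keys_iff\<close>)
  also have "\<dots> = (\<Sum>i\<in>{1..length a}. a ! (i - 1))"
    by (rule sum.cong) (auto simp: lookup_word_exponents)
  also have "\<dots> = (\<Sum>i=0..<length a. a ! i)"
    by (rule sum.reindex_bij_witness[of _ Suc "\<lambda>i. i - 1"]) auto
  finally show ?thesis by (simp add: sum_list_sum_nth)
qed

lemma ex_word_exponents:
  assumes "Poly_Mapping.keys e \<subseteq> {1..n}"
  obtains a where "length a = n" "e = word_exponents a"
proof
  let ?a = "map (\<lambda>i. Poly_Mapping.lookup e (Suc i)) [0..<n]"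
  show "length ?a = n" by simp
  show "e = word_exponents ?a"
  proof (rule poly_mapping_eqI)
    fix i
    have "i \<notin> {1..n} \<Longrightarrow> Poly_Mapping.lookup e i = 0" using assms by (auto simp: in_keys_iff)
    then show "Poly_Mapping.lookup e i = Poly_Mapping.lookup (word_exponents ?a) i"
      by (auto simp: lookup_word_exponents)
  qed
qed

lemma word_monom_eq_single: "word_monom a = Poly_Mapping.single (word_exponents a) 1"
proof -
  have pow: "mvar i ^ m = Poly_Mapping.single (Poly_Mapping.single i m) 1" for i m
    by (induction m) (simp_all add: mvar_def mult_single flip: single_add)
  have "(\<Prod>i\<in>A. mvar i ^ g i) = Poly_Mapping.single (\<Sum>i\<in>A. Poly_Mapping.single i (g i)) 1"
    for A and g :: "nat \<Rightarrow> nat"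
    by (induction A rule: infinite_finite_induct) (simp_all add: pow mult_single)
  then show ?thesis unfolding word_monom_def word_exponents_def .
qed

lemma lookup_word_monom:
  assumes "length a = length b"
  shows "Poly_Mapping.lookup (word_monom a) (word_exponents b) = (if a = b then 1 else 0)"
  using word_exponents_inject[OF assms]
  by (auto simp: word_monom_eq_single lookup_single when_def)

section \<open>Homogeneous polynomials as combinations of word monomials\<close>

definition weighted_words :: "nat \<Rightarrow> nat \<Rightarrow> nat list set" where
  "weighted_words n k = {a. length a = n \<and> sum_list a = k}"

lemma finite_weighted_words: "finite (weighted_words n k)"
proof (rule finite_subset)
  show "weighted_words n k \<subseteq> {a. set a \<subseteq> {..k} \<and> length a = n}"
    using member_le_sum_list by (auto simp: weighted_words_def)
qed (simp add: finite_lists_length_eq)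

lemma cyc_shift_pow_weighted_words:
  assumes "a \<in> weighted_words n k"
  shows "(cyc_shift ^^ i) a \<in> weighted_words n k"
proof -
  have r: "sum_list (rotate1 w) = sum_list w" for w :: "nat list"
    by (cases w) simp_all
  \<comment> \<open>\<open>rotate1\<close> is easy to unfold on a cons and undoes
    \<open>cyc_shift\<close>, so the identity passes to the inverse.\<close>
  have "sum_list (cyc_shift w) = sum_list w" for w :: "nat list"
    using r[of "cyc_shift w"] by simp
  then have "sum_list ((cyc_shift ^^ i) a) = sum_list a"
    by (induction i) simp_all
  then show ?thesis using assms by (simp add: weighted_words_def)
qed

lemma keys_homogeneous_polys:
  assumes "f \<in> homogeneous_polys n k"
  shows "Poly_Mapping.keys f \<subseteq> word_exponents ` weighted_words n k"
proof
  fix e assume e: "e \<in> Poly_Mapping.keys f"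
  then have "Poly_Mapping.keys e \<subseteq> {1..n}" using assms by (auto simp: homogeneous_polys_def)
  then obtain a where "length a = n" "e = word_exponents a" using ex_word_exponents by blast
  then show "e \<in> word_exponents ` weighted_words n k"
    using assms e sum_lookup_word_exponents[of a]
    by (auto simp: homogeneous_polys_def weighted_words_def)
qed

lemma homogeneous_polys_iff_keys:
  "f \<in> homogeneous_polys n k \<longleftrightarrow> Poly_Mapping.keys f \<subseteq> word_exponents ` weighted_words n k"
proof
  assume "Poly_Mapping.keys f \<subseteq> word_exponents ` weighted_words n k"
  then show "f \<in> homogeneous_polys n k"
    using keys_word_exponents sum_lookup_word_exponents
    by (fastforce simp: homogeneous_polys_def weighted_words_def)
qed (rule keys_homogeneous_polys)

lemma word_monom_homogeneous:
  "a \<in> weighted_words n k \<Longrightarrow> word_monom a \<in> homogeneous_polys n k"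
  by (auto simp: homogeneous_polys_iff_keys word_monom_eq_single)

lemma subspace_homogeneous_polys: "mpoly.subspace (homogeneous_polys n k)"
proof (rule mpoly.subspaceI)
  fix c :: complex and f g :: mpoly
  assume f: "f \<in> homogeneous_polys n k"
  have "Poly_Mapping.keys (mscale c f) \<subseteq> Poly_Mapping.keys f"
    by (auto simp: in_keys_iff lookup_mscale)
  then show "mscale c f \<in> homogeneous_polys n k"
    using f by (auto simp: homogeneous_polys_iff_keys)
  assume "g \<in> homogeneous_polys n k"
  then show "f + g \<in> homogeneous_polys n k"
    using f keys_add[of f g] unfolding homogeneous_polys_iff_keys by blast
qed (simp add: homogeneous_polys_iff_keys)

text \<open>Among words of length \<open>n\<close> an exponent vector determines its word, so each
  monomial in the support is met by exactly one summand.\<close>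

lemma homogeneous_poly_expansion:
  assumes "f \<in> homogeneous_polys n k"
  shows "f = (\<Sum>a\<in>weighted_words n k.
                mscale (Poly_Mapping.lookup f (word_exponents a)) (word_monom a))"
proof (rule poly_mapping_eqI)
  fix e
  let ?W = "weighted_words n k"
  let ?g = "\<Sum>a\<in>?W. mscale (Poly_Mapping.lookup f (word_exponents a)) (word_monom a)"
  have g: "Poly_Mapping.lookup ?g e
      = (\<Sum>a\<in>?W. Poly_Mapping.lookup f (word_exponents a) * (1 when word_exponents a = e))"
    by (simp add: lookup_sum_mpoly lookup_mscale word_monom_eq_single lookup_single)
  show "Poly_Mapping.lookup f e = Poly_Mapping.lookup ?g e"
  proof (cases "e \<in> word_exponents ` ?W")
    case True
    then obtain b where b: "b \<in> ?W" "e = word_exponents b" by blast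
    have "Poly_Mapping.lookup ?g e
        = (\<Sum>a\<in>?W. if a = b then Poly_Mapping.lookup f (word_exponents b) else 0)"
      unfolding g
    proof (rule sum.cong)
      fix a assume "a \<in> ?W"
      then have "word_exponents a = e \<longleftrightarrow> a = b"
        using b word_exponents_inject[of a b] by (auto simp: weighted_words_def)
      then show "Poly_Mapping.lookup f (word_exponents a) * (1 when word_exponents a = e)
          = (if a = b then Poly_Mapping.lookup f (word_exponents b) else 0)"
        by (auto simp: when_def)
    qed simp
    then show ?thesis using b finite_weighted_words by simp
  next
    case False
    then have "Poly_Mapping.lookup f e = 0"
      using keys_homogeneous_polys[OF assms] by (meson in_keys_iff subsetD)
    moreover have "Poly_Mapping.lookup ?g e = 0"
      unfolding g using False by (intro sum.neutral) (auto simp: when_def)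
    ultimately show ?thesis by simp
  qed
qed

section \<open>The cyclic substitution\<close>

text \<open>A common finite index set lets linearity be proved termwise; the additional exponents
  have coefficient 0.\<close>

lemma msubst_superset:
  assumes "finite A" "Poly_Mapping.keys p \<subseteq> A"
  shows "msubst s p = (\<Sum>e\<in>A. mscale (Poly_Mapping.lookup p e)
     (\<Prod>i\<in>Poly_Mapping.keys e. s i ^ Poly_Mapping.lookup e i))"
  unfolding msubst_def using assms by (intro sum.mono_neutral_left) (auto simp: in_keys_iff)

lemma msubst_add: "msubst s (p + q) = msubst s p + msubst s q"
proof -
  let ?A = "Poly_Mapping.keys p \<union> Poly_Mapping.keys q"
  have "Poly_Mapping.keys (p + q) \<subseteq> ?A" by (rule keys_add)
  then show ?thesis
    by (simp add: msubst_superset[of ?A] lookup_add mpoly.scale_left_distrib sum.distrib)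
qed

lemma msubst_mscale: "msubst s (mscale c p) = mscale c (msubst s p)"
proof -
  have "Poly_Mapping.keys (mscale c p) \<subseteq> Poly_Mapping.keys p"
    by (auto simp: in_keys_iff lookup_mscale)
  then show ?thesis
    by (simp add: msubst_superset[of "Poly_Mapping.keys p"] lookup_mscale mpoly.scale_sum_right)
qed

lemma msubst_sum: "msubst s (\<Sum>x\<in>A. p x) = (\<Sum>x\<in>A. msubst s (p x))"
  by (induction A rule: infinite_finite_induct) (simp_all add: msubst_add msubst_def[of _ 0])

text \<open>With letters counted from 1, letter \<open>i\<close> moves to place
  \<open>i + 1\<close>, which is list index \<open>i\<close>; the modulus sends the last letter to
  index 0.\<close>

lemma nth_cyc_shift:
  assumes "i \<in> {1..length a}"
  shows "cyc_shift a ! (i mod length a) = a ! (i - 1)"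
proof -
  have "rotate1 (cyc_shift a) ! (i - 1) = cyc_shift a ! (Suc (i - 1) mod length (cyc_shift a))"
    using assms length_cyc_shift_pow[of 1 a] by (intro nth_rotate1) auto
  then show ?thesis using assms length_cyc_shift_pow[of 1 a] by simp
qed

lemma bij_betw_cyclic_successor: "bij_betw (\<lambda>i. i mod n + 1) {1..n} {1..n::nat}"
proof (rule bij_betw_byWitness[where f' = "\<lambda>i. if i = 1 then n else i - 1"])
  have "i = n \<or> i < n" if "i \<in> {1..n}" for i using that by auto
  then show "\<forall>i\<in>{1..n}. (if i mod n + 1 = 1 then n else i mod n + 1 - 1) = i"
    by fastforce
qed (auto simp: Suc_leI split: if_splits)

text \<open>Replacing each variable by its cyclic successor moves the exponent from place
  \<open>i\<close> to place \<open>i + 1\<close>, just as the shift moves letters. Reindexing the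
  product along the successor bijection gives the new monomial.\<close>

lemma msubst_word_monom:
  assumes "length a = n"
  shows "msubst (\<lambda>i. mvar (i mod n + 1)) (word_monom a) = word_monom (cyc_shift a)"
proof -
  let ?e = "word_exponents a"
  have l: "length (cyc_shift a) = n" using assms length_cyc_shift_pow[of 1 a] by simp
  have "msubst (\<lambda>i. mvar (i mod n + 1)) (word_monom a)
      = (\<Prod>i\<in>Poly_Mapping.keys ?e. mvar (i mod n + 1) ^ Poly_Mapping.lookup ?e i)"
    by (simp add: msubst_def word_monom_eq_single)
  \<comment> \<open>Indices outside the support have exponent 0 and contribute the factor 1.\<close>
  also have "\<dots> = (\<Prod>i=1..n. mvar (i mod n + 1) ^ Poly_Mapping.lookup ?e i)"
    using keys_word_exponents[of a] assms
    by (intro prod.mono_neutral_left) (auto simp: in_keys_iff)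
  also have "\<dots> = (\<Prod>i=1..n. mvar (i mod n + 1) ^ (cyc_shift a ! (i mod n + 1 - 1)))"
    using nth_cyc_shift[of _ a] assms by (intro prod.cong) (auto simp: lookup_word_exponents)
  also have "\<dots> = (\<Prod>i=1..n. mvar i ^ (cyc_shift a ! (i - 1)))"
    by (rule prod.reindex_bij_betw[OF bij_betw_cyclic_successor])
  finally show ?thesis unfolding word_monom_def l .
qed

section \<open>Necklace polynomials\<close>

lemma primitive_root_power_eq_1_iff:
  assumes "primitive_root_of_unity n \<omega>" "1 \<le> n"
  shows "\<omega> ^ i = 1 \<longleftrightarrow> n dvd i"
proof
  assume i: "\<omega> ^ i = 1"
  have "\<omega> ^ i = (\<omega> ^ n) ^ (i div n) * \<omega> ^ (i mod n)"
    by (metis mult_div_mod_eq power_add power_mult)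
  then have "\<omega> ^ (i mod n) = 1" using i assms(1) by (simp add: primitive_root_of_unity_def)
  moreover have "i mod n < n" using assms(2) by simp
  ultimately have "i mod n = 0" using assms(1) by (auto simp: primitive_root_of_unity_def)
  then show "n dvd i" by (simp add: dvd_eq_mod_eq_0)
next
  assume "n dvd i"
  then show "\<omega> ^ i = 1" using assms(1) by (auto simp: primitive_root_of_unity_def power_mult)
qed

lemma powi_minus_mult: "\<omega> powi (- (int i * int j)) = inverse (\<omega> ^ (i * j))"
  for \<omega> :: complex
  by (metis of_nat_mult power_int_minus power_int_of_nat)

lemma primitive_root_nonzero:
  assumes "primitive_root_of_unity n \<omega>" "1 \<le> n"
  shows "\<omega> \<noteq> 0"
  using assms by (auto simp: primitive_root_of_unity_def power_0_left)

text \<open>Starting from the shifted word moves the summation index by one, which yields the factor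
  \<open>\<omega> ^ j\<close>; a sum over the whole cycle does not depend on where it
  starts.\<close>

lemma necklace_poly_cyc_shift:
  assumes \<omega>: "primitive_root_of_unity n \<omega>" and n: "1 \<le> n" and a: "length a = n"
  shows "necklace_poly n \<omega> j (cyc_shift a) = mscale (\<omega> ^ j) (necklace_poly n \<omega> j a)"
proof -
  define g where "g i = mscale (inverse (\<omega> ^ (i * j))) (word_monom ((cyc_shift ^^ i) a))" for i
  have nz: "\<omega> \<noteq> 0" using primitive_root_nonzero[OF \<omega> n] .
  have root: "\<omega> ^ (n * j) = 1" using primitive_root_power_eq_1_iff[OF \<omega> n] by simp
  have fixed: "(cyc_shift ^^ n) a = a" using cyc_shift_pow_mult_length[of 1 a] a by simp
  have g_Suc: "mscale (inverse (\<omega> ^ (i * j))) (word_monom ((cyc_shift ^^ i) (cyc_shift a)))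
      = mscale (\<omega> ^ j) (g (Suc i))" for i
    using nz by (simp add: g_def funpow_swap1 power_add field_simps)
  have "\<omega> ^ (n * j + j) = \<omega> ^ j" using root by (simp add: power_add)
  then have period: "g (Suc n) = g 1"
    using fixed by (simp add: g_def add.commute)
  \<comment> \<open>The index ranges from 1 to \<open>n\<close> and from 2 to \<open>n + 1\<close>
    differ only in the terms \<open>g 1\<close> and \<open>g (Suc n)\<close>, which agree.\<close>
  have "(\<Sum>i=1..n. g (Suc i)) = (\<Sum>i=1..n. g i)"
  proof -
    have "(\<Sum>i=1..n. g (Suc i)) = (\<Sum>i=Suc 1..Suc n. g i)"
      by (rule sum.shift_bounds_cl_Suc_ivl[symmetric])
    also have "g 1 + \<dots> = (\<Sum>i=1..Suc n. g i)"
      by (rule sum.atLeast_Suc_atMost[symmetric]) simp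
    also have "\<dots> = (\<Sum>i=1..n. g i) + g (Suc n)" by simp
    finally show ?thesis using period by simp
  qed
  then show ?thesis
    unfolding necklace_poly_def powi_minus_mult g_Suc
    unfolding mpoly.scale_sum_right[symmetric] g_def[symmetric]
    by (simp add: mult.commute)
qed

lemma necklace_poly_cyc_shift_pow:
  assumes "primitive_root_of_unity n \<omega>" "1 \<le> n" "length a = n"
  shows "necklace_poly n \<omega> j ((cyc_shift ^^ i) a) = mscale (\<omega> ^ (i * j)) (necklace_poly n \<omega> j a)"
  using assms by (induction i) (simp_all add: necklace_poly_cyc_shift power_add)

text \<open>Shifting by the period fixes the word but multiplies its polynomial by a power of
  \<open>\<omega>\<close> that differs from 1.\<close>

lemma necklace_poly_eq_0:
  assumes "primitive_root_of_unity n \<omega>" "1 \<le> n" "length a = n"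
    and "\<not> n dvd period (necklace a) * j"
  shows "necklace_poly n \<omega> j a = 0"
proof -
  have "necklace_poly n \<omega> j a = mscale (\<omega> ^ (period (necklace a) * j)) (necklace_poly n \<omega> j a)"
    using necklace_poly_cyc_shift_pow[OF assms(1-3)] period_necklace_pos_fixed by metis
  then have "mscale (1 - \<omega> ^ (period (necklace a) * j)) (necklace_poly n \<omega> j a) = 0"
    by (simp add: mpoly.scale_left_diff_distrib)
  then show ?thesis
    using primitive_root_power_eq_1_iff[OF assms(1,2)] assms(4) by simp
qed

lemma msubst_necklace_poly:
  assumes "length a = n"
  shows "msubst (\<lambda>i. mvar (i mod n + 1)) (necklace_poly n \<omega> j a) = necklace_poly n \<omega> j (cyc_shift a)"
proof -
  have "msubst (\<lambda>i. mvar (i mod n + 1)) (word_monom ((cyc_shift ^^ i) a))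
      = word_monom ((cyc_shift ^^ i) (cyc_shift a))" for i
    using assms by (simp add: msubst_word_monom funpow_swap1 del: One_nat_def)
  then show ?thesis
    unfolding necklace_poly_def msubst_mscale msubst_sum by simp
qed

lemma necklace_poly_relative_invariant:
  assumes \<omega>: "primitive_root_of_unity n \<omega>" "1 \<le> n" and a: "a \<in> weighted_words n k"
  shows "necklace_poly n \<omega> j a \<in> relative_invariants n k \<omega> j"
proof -
  have "necklace_poly n \<omega> j a \<in> homogeneous_polys n k"
    unfolding necklace_poly_def
    by (intro mpoly.subspace_scale mpoly.subspace_sum subspace_homogeneous_polys
        word_monom_homogeneous cyc_shift_pow_weighted_words a)
  moreover have "length a = n" using a by (simp add: weighted_words_def)
  ultimately show ?thesis
    using necklace_poly_cyc_shift[OF \<omega>] msubst_necklace_poly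
    by (simp add: relative_invariants_def del: One_nat_def add_Suc_right)
qed

section \<open>Spanning by averaging over the cyclic group\<close>

lemma subspace_relative_invariants: "mpoly.subspace (relative_invariants n k \<omega> j)"
  using subspace_homogeneous_polys[of n k]
  by (auto simp: mpoly.subspace_def relative_invariants_def msubst_add msubst_mscale
      mpoly.scale_right_distrib mpoly.scale_left_commute msubst_def[of _ 0])

text \<open>After correction by the inverse power of \<open>\<omega>\<close>, each iterate of the
  substitution returns \<open>f\<close>, so \<open>f\<close> is the average of these terms.
  Expanding them into word monomials turns the average into necklace polynomials. The sum runs over
  all words, so several words may belong to the same necklace.\<close>

lemma relative_invariant_expansion:
  assumes \<omega>: "primitive_root_of_unity n \<omega>" "1 \<le> n"
    and f: "f \<in> relative_invariants n k \<omega> j"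
  shows "f = (\<Sum>a\<in>weighted_words n k.
                mscale (Poly_Mapping.lookup f (word_exponents a)) (necklace_poly n \<omega> j a))"
proof -
  let ?W = "weighted_words n k" and ?c = "\<lambda>a. Poly_Mapping.lookup f (word_exponents a)"
  let ?T = "msubst (\<lambda>i. mvar (i mod n + 1))"
  have hom: "f \<in> homogeneous_polys n k" and T: "?T f = mscale (\<omega> ^ j) f"
    using f by (auto simp: relative_invariants_def)
  \<comment> \<open>The \<open>i\<close>-fold substitution scales \<open>f\<close> by
    \<open>\<omega> ^ (i * j)\<close> and shifts every monomial \<open>i\<close> times.\<close>
  have orbit: "mscale (\<omega> ^ (i * j)) f = (\<Sum>a\<in>?W. mscale (?c a) (word_monom ((cyc_shift ^^ i) a)))" for i
  proof (induction i)
    case 0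
    show ?case using homogeneous_poly_expansion[OF hom] by simp
  next
    case (Suc i)
    have "mscale (\<omega> ^ (Suc i * j)) f = ?T (mscale (\<omega> ^ (i * j)) f)"
      by (simp add: msubst_mscale T power_add mult.commute del: One_nat_def add_Suc_right)
    also have "\<dots> = (\<Sum>a\<in>?W. mscale (?c a) (?T (word_monom ((cyc_shift ^^ i) a))))"
      unfolding Suc msubst_sum msubst_mscale ..
    also have "\<dots> = (\<Sum>a\<in>?W. mscale (?c a) (word_monom ((cyc_shift ^^ Suc i) a)))"
      by (intro sum.cong refl)
        (simp add: weighted_words_def msubst_word_monom del: One_nat_def add_Suc_right)
    finally show ?case .
  qed
  have nz: "\<omega> \<noteq> 0" using primitive_root_nonzero[OF \<omega>] .
  have "(\<Sum>a\<in>?W. mscale (?c a) (necklace_poly n \<omega> j a))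
      = mscale (1 / of_nat n) (\<Sum>a\<in>?W. \<Sum>i=1..n. mscale (inverse (\<omega> ^ (i * j)))
           (mscale (?c a) (word_monom ((cyc_shift ^^ i) a))))"
    unfolding necklace_poly_def powi_minus_mult
    by (simp add: mpoly.scale_sum_right mult.commute mult.left_commute)
  \<comment> \<open>Exchanging the sums lets \<open>orbit\<close> recognize the sum over words as a
    multiple of \<open>f\<close>; the two powers of \<open>\<omega>\<close> then cancel.\<close>
  also have "\<dots> = mscale (1 / of_nat n) (\<Sum>i=1..n. mscale (inverse (\<omega> ^ (i * j)))
           (mscale (\<omega> ^ (i * j)) f))"
    unfolding orbit mpoly.scale_sum_right by (subst sum.swap) (rule refl)
  also have "\<dots> = mscale (1 / of_nat n) (\<Sum>i=1..n. f)" using nz by simp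
  also have "(\<Sum>i=1..n. f) = mscale (of_nat n) f"
    by (simp add: mpoly.sum_constant_scale del: sum_constant)
  also have "mscale (1 / of_nat n) \<dots> = f" using \<omega>(2) by simp
  finally show ?thesis by simp
qed

section \<open>Linear independence by comparing coefficients\<close>

lemma lookup_necklace_poly_self:
  assumes \<omega>: "primitive_root_of_unity n \<omega>" "1 \<le> n" and a: "length a = n"
    and div: "n dvd period (necklace a) * j"
  shows "Poly_Mapping.lookup (necklace_poly n \<omega> j a) (word_exponents a) \<noteq> 0"
proof -
  let ?S = "{i \<in> {1..n}. (cyc_shift ^^ i) a = a}"
  have root: "\<omega> ^ (i * j) = 1" if "(cyc_shift ^^ i) a = a" for i
  proof -
    have "period (necklace a) * j dvd i * j"
      using that by (simp add: period_necklace_dvd_iff mult_dvd_mono)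
    then show ?thesis
      using div primitive_root_power_eq_1_iff[OF \<omega>] dvd_trans by blast
  qed
  have "Poly_Mapping.lookup (necklace_poly n \<omega> j a) (word_exponents a)
      = 1 / of_nat n * (\<Sum>i=1..n. inverse (\<omega> ^ (i * j)) * (if (cyc_shift ^^ i) a = a then 1 else 0))"
    unfolding necklace_poly_def powi_minus_mult
    by (simp add: lookup_mscale lookup_sum_mpoly lookup_word_monom)
  \<comment> \<open>Only shifts fixing \<open>a\<close> contribute, and by \<open>root\<close> each
    has weight 1, so nothing can cancel.\<close>
  also have "(\<Sum>i=1..n. inverse (\<omega> ^ (i * j)) * (if (cyc_shift ^^ i) a = a then 1 else 0))
      = (\<Sum>i=1..n. if (cyc_shift ^^ i) a = a then 1 else 0)"
    by (intro sum.cong refl) (simp add: root)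
  also have "\<dots> = of_nat (card ?S)"
    by (simp add: sum.If_cases Int_def)
  finally have eq: "Poly_Mapping.lookup (necklace_poly n \<omega> j a) (word_exponents a)
      = 1 / of_nat n * of_nat (card ?S)" .
  \<comment> \<open>The full turn by \<open>n\<close> always fixes \<open>a\<close>, so the count is
    positive.\<close>
  have "n \<in> ?S" using \<omega>(2) a cyc_shift_pow_mult_length[of 1 a] by simp
  then have "card ?S \<noteq> 0" by auto
  then show ?thesis using eq \<omega>(2) by simp
qed

text \<open>Only monomials of shifts of \<open>a\<close> occur, and \<open>b\<close> is not one of
  these shifts.\<close>

lemma lookup_necklace_poly_other:
  assumes "length a = n" "length b = n" "necklace a \<noteq> necklace b"
  shows "Poly_Mapping.lookup (necklace_poly n \<omega> j a) (word_exponents b) = 0"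
proof -
  have "(cyc_shift ^^ i) a \<noteq> b" for i
    using assms(3) by (auto simp: necklace_eq_iff shift_rel_def)
  then show ?thesis
    unfolding necklace_poly_def using assms
    by (simp add: lookup_mscale lookup_sum_mpoly lookup_word_monom)
qed

text \<open>Among the family, the coefficient at \<open>e x\<close> is nonzero for
  \<open>f x\<close> alone, so reading it off a vanishing combination forces the scalar of
  \<open>f x\<close> to be 0. The same coefficients separate the members of the family, so distinct
  necklaces give distinct basis vectors.\<close>

lemma independent_lookup:
  fixes f :: "'b \<Rightarrow> mpoly" and e :: "'b \<Rightarrow> nat \<Rightarrow>\<^sub>0 nat"
  assumes self: "\<And>x. x \<in> D \<Longrightarrow> Poly_Mapping.lookup (f x) (e x) \<noteq> 0"
    and other: "\<And>x y. x \<in> D \<Longrightarrow> y \<in> D \<Longrightarrow> x \<noteq> y \<Longrightarrow> Poly_Mapping.lookup (f x) (e y) = 0"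
  shows "inj_on f D" "mpoly.independent (f ` D)"
proof -
  show inj: "inj_on f D"
    using self other by (intro inj_onI) metis
  show "mpoly.independent (f ` D)"
    unfolding mpoly.dependent_explicit
  proof (rule notI, elim exE conjE bexE)
    fix t u v
    assume t: "finite t" "t \<subseteq> f ` D" and 0: "(\<Sum>v\<in>t. mscale (u v) v) = 0"
      and v: "v \<in> t" "u v \<noteq> 0"
    then obtain x where x: "x \<in> D" "v = f x" by blast
    have "0 = Poly_Mapping.lookup (\<Sum>v\<in>t. mscale (u v) v) (e x)" unfolding 0 by simp
    also have "\<dots> = (\<Sum>w\<in>t. u w * Poly_Mapping.lookup w (e x))"
      by (simp add: lookup_sum_mpoly lookup_mscale)
    also have "\<dots> = (\<Sum>w\<in>{v}. u w * Poly_Mapping.lookup w (e x))"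
      using t v x other by (intro sum.mono_neutral_right) auto
    finally show False using self[OF x(1)] v x by simp
  qed
qed

section \<open>Representatives of binary necklaces by words\<close>

lemma binary_necklace_representative:
  assumes "n \<ge> 1" "N \<in> binary_necklaces n k" "b \<in> code N"
  shows "N = necklace (code_word b)" "code N = necklace b" "b \<in> weighted_words n k"
proof -
  obtain as where as: "N = necklace (code_word as)" "length as = n" "sum_list as = k"
    using binary_necklaces_code_word[OF assms(1,2)] by blast
  have code: "code N = necklace as" unfolding as(1) by (rule code_necklace)
  \<comment> \<open>\<open>code N\<close> consists of the shifts of \<open>as\<close>, so any chosen
    \<open>b\<close> has the same necklace, length and sum.\<close>
  then obtain i where i: "b = (cyc_shift ^^ i) as"
    using assms(3) by (auto simp: necklace_def shift_rel_def)
  then have eq: "necklace as = necklace b" by (auto simp: necklace_eq_iff shift_rel_def)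
  then show "N = necklace (code_word b)" using as(1) by (simp add: necklace_code_word_eq_iff)
  show "code N = necklace b" using code eq by simp
  show "b \<in> weighted_words n k"
    unfolding i using as by (intro cyc_shift_pow_weighted_words) (simp add: weighted_words_def)
qed

lemma necklace_code_word_in_binary_necklaces:
  "b \<in> weighted_words n k \<Longrightarrow> necklace (code_word b) \<in> binary_necklaces n k"
  unfolding binary_necklaces_def necklace_def
  by (intro quotientI) (simp add: weighted_words_def count_code_word)

theorem theorem6p3:
  fixes n k j m\<^sub>j n\<^sub>j :: nat and \<omega> :: complex
    and a :: "bead list set \<Rightarrow> nat list"
  assumes n: "n \<ge> 1"
    and \<omega>: "primitive_root_of_unity n \<omega>"
    and j: "j \<in> {1..n}"
    and m\<^sub>j: "m\<^sub>j = (n + k) div gcd n (gcd k j)"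
    and n\<^sub>j: "n\<^sub>j = n div gcd n j"
    and a: "\<And>N. N \<in> binary_necklaces n k \<Longrightarrow> a N \<in> code N"
  shows "(\<forall>N\<in>binary_necklaces n k.
            divisible_necklace m\<^sub>j N \<longleftrightarrow> divisible_necklace n\<^sub>j (code N)) \<and>
         (let D = {N \<in> binary_necklaces n k. divisible_necklace m\<^sub>j N};
              f = (\<lambda>N. necklace_poly n \<omega> j (a N))
          in inj_on f D \<and> mpoly.independent (f ` D) \<and>
             mpoly.span (f ` D) = relative_invariants n k \<omega> j)"
proof -
  define D where "D = {N \<in> binary_necklaces n k. divisible_necklace m\<^sub>j N}"
  define f where "f N = necklace_poly n \<omega> j (a N)" for N
  \<comment> \<open>Membership of a necklace is supplied twice below: once as a premise on
    \<open>N\<close>, once to obtain \<open>a N \<in> code N\<close>.\<close>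
  note rep = binary_necklace_representative[OF n _ a]
  have words: "length (a N) = n" "sum_list (a N) = k" if "N \<in> binary_necklaces n k" for N
    using rep(3)[OF that that] by (simp_all add: weighted_words_def)
  have div_iff: "divisible_necklace m\<^sub>j N \<longleftrightarrow> n dvd period (necklace (a N)) * j"
    if N: "N \<in> binary_necklaces n k" for N
    using divisible_code_iff(1)[OF words[OF N] n] rep(1)[OF N N]
    by (simp add: divisible_necklace_def m\<^sub>j)
  have code_iff: "divisible_necklace n\<^sub>j (code N) \<longleftrightarrow> n dvd period (necklace (a N)) * j"
    if N: "N \<in> binary_necklaces n k" for N
    using divisible_code_iff(2)[OF words[OF N] n] rep(2)[OF N N]
    by (simp add: divisible_necklace_def n\<^sub>j)
  have self: "Poly_Mapping.lookup (f N) (word_exponents (a N)) \<noteq> 0" if "N \<in> D" for N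
    using that lookup_necklace_poly_self[OF \<omega> n words(1)] div_iff by (auto simp: D_def f_def)
  have other: "Poly_Mapping.lookup (f M) (word_exponents (a N)) = 0"
    if "M \<in> D" "N \<in> D" "M \<noteq> N" for M N
    unfolding f_def
  proof (rule lookup_necklace_poly_other)
    \<comment> \<open>Each necklace is recovered from its chosen word by \<open>code_word\<close>,
      so distinct necklaces have distinct codes.\<close>
    show "necklace (a M) \<noteq> necklace (a N)"
      using that rep(1) necklace_code_word_eq_iff by (metis (mono_tags, lifting) D_def mem_Collect_eq)
  qed (use that words in \<open>auto simp: D_def\<close>)
  have "mpoly.span (f ` D) = relative_invariants n k \<omega> j"
  proof
    show "mpoly.span (f ` D) \<subseteq> relative_invariants n k \<omega> j"
      using necklace_poly_relative_invariant[OF \<omega> n] rep(3)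
      by (intro mpoly.span_minimal subspace_relative_invariants) (auto simp: D_def f_def)
    show "relative_invariants n k \<omega> j \<subseteq> mpoly.span (f ` D)"
    proof
      fix p assume p: "p \<in> relative_invariants n k \<omega> j"
      \<comment> \<open>The expansion involves arbitrary words, so each polynomial is first related
        to that of the representative chosen for its necklace; they differ by a power of
        \<open>\<omega>\<close>.\<close>
      have "necklace_poly n \<omega> j b \<in> mpoly.span (f ` D)" if b: "b \<in> weighted_words n k" for b
      proof -
        define N where "N = necklace (code_word b)"
        have N: "N \<in> binary_necklaces n k"
          unfolding N_def using b by (rule necklace_code_word_in_binary_necklaces)
        have "necklace (a N) = necklace b"
          using rep(2)[OF N N] by (simp add: N_def code_necklace)
        then obtain i where i: "b = (cyc_shift ^^ i) (a N)"
          by (auto simp: necklace_eq_iff shift_rel_def)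
        then have eq: "necklace_poly n \<omega> j b = mscale (\<omega> ^ (i * j)) (f N)"
          using necklace_poly_cyc_shift_pow[OF \<omega> n words(1)[OF N]] by (simp add: f_def)
        show ?thesis
        proof (cases "N \<in> D")
          case True
          then show ?thesis unfolding eq by (intro mpoly.span_scale mpoly.span_base imageI)
        next
          \<comment> \<open>A necklace outside \<open>D\<close> fails the divisibility condition, so
            its polynomial vanishes and adds nothing to the span.\<close>
          case False
          then have "f N = 0"
            using N necklace_poly_eq_0[OF \<omega> n words(1)[OF N]] div_iff[OF N]
            by (simp add: D_def f_def)
          then show ?thesis unfolding eq by (simp add: mpoly.span_zero)
        qed
      qed
      then show "p \<in> mpoly.span (f ` D)"
        by (subst relative_invariant_expansion[OF \<omega> n p])
          (intro mpoly.span_sum mpoly.span_scale)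
    qed
  qed
  then show ?thesis
    using div_iff code_iff independent_lookup[of D f "\<lambda>N. word_exponents (a N)", OF self other]
    unfolding Let_def D_def[symmetric] f_def[symmetric] by blast
qed

end
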